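(* Let $f \in \mathcal{P}^*$ be given by $f(z) = z + \sum_{n=2}^{\infty} a_n z^n$. Then $$|\sigma_3(f)(0)| \le 4 \quad\text{and}\quad |\sigma_4(f)(0)| \le 15.$$ These bounds are sharp, i.e. for each of the two inequalities there is a function in $\mathcal{P}^*$ for which equality holds.
   Context: $\mathbb{D}=\{z\in\mathbb{C}:|z|<1\}$. $\mathcal{A}$ is the class of analytic functions $f$ on $\mathbb{D}$ with $f(0)=0$, $f'(0)=1$. For analytic $f,g$ on $\mathbb{D}$, $f\prec g$ (subordination) means there is an analytic function $\omega$ on $\mathbb{D}$ with $\omega(0)=0$, $|\omega(z)|<1$ and $f(z)=g(\omega(z))$ for all $z\in\mathbb{D}$. $\mathcal{P}^*$ is the class of $f\in\mathcal{A}$ such that $f'(z)\prec e^z(1+\sin z)$. Higher-order (Schippers) Schwarzian derivatives of a locally univalent function $f$ on $\mathbb{D}$: $\sigma_3(f)=S_f=\left(\frac{f''}{f'}\right)'-\frac12\left(\frac{f''}{f'}\right)^2$ and, for $n\ge 3$, $\sigma_{n+1}(f)=\sigma_n'(f)-(n-1)\sigma_n(f)\frac{f''}{f'}$, where $\sigma_n'(f)$ is the derivative of the function $\sigma_n(f)$ with respect to $z$. For $f(z)=z+\sum_{n\ge2}a_nz^n$ the values at the origin are $\sigma_3(f)(0)=6(a_3-a_2^2)$ and $\sigma_4(f)(0)=24(a_4-3a_2a_3+2a_2^3)$. *)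

theory Defs
  imports "HOL-Complex_Analysis.Complex_Analysis"
begin

abbreviation unit_disc :: "complex set" ("\<D>")
  where "\<D> \<equiv> ball 0 1"

text \<open>Functions on the disc are total functions on the complex plane; their values outside
  \<open>\<D>\<close> are irrelevant, since \<^const>\<open>deriv\<close> at a point of the open disc is determined by the
  values near that point.\<close>

definition class_A :: "(complex \<Rightarrow> complex) set" where
  "class_A = {f. f holomorphic_on \<D> \<and> f 0 = 0 \<and> deriv f 0 = 1}"

definition subordinate :: "(complex \<Rightarrow> complex) \<Rightarrow> (complex \<Rightarrow> complex) \<Rightarrow> bool"
    (infix "\<prec>\<^sub>D" 50) where
  "f \<prec>\<^sub>D g \<longleftrightarrow> f holomorphic_on \<D> \<and> g holomorphic_on \<D> \<and>
     (\<exists>\<omega>. \<omega> holomorphic_on \<D> \<and> \<omega> 0 = 0 \<and>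
        (\<forall>z\<in>\<D>. norm (\<omega> z) < 1 \<and> f z = g (\<omega> z)))"

definition class_P_star :: "(complex \<Rightarrow> complex) set" where
  "class_P_star = {f \<in> class_A. deriv f \<prec>\<^sub>D (\<lambda>z. exp z * (1 + sin z))}"

definition pre_Schwarzian :: "(complex \<Rightarrow> complex) \<Rightarrow> complex \<Rightarrow> complex" where
  "pre_Schwarzian f z = deriv (deriv f) z / deriv f z"

definition Schwarzian :: "(complex \<Rightarrow> complex) \<Rightarrow> complex \<Rightarrow> complex" where
  "Schwarzian f z = deriv (pre_Schwarzian f) z - 1 / 2 * (pre_Schwarzian f z)\<^sup>2"

text \<open>Schippers' higher-order Schwarzian derivatives. The recursion starts at index 3;
  the value 0 at the indices 0, 1, 2 is a placeholder.\<close>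

primrec higher_Schwarzian :: "nat \<Rightarrow> (complex \<Rightarrow> complex) \<Rightarrow> complex \<Rightarrow> complex" ("\<sigma>") where
  "\<sigma> 0 f = (\<lambda>z. 0)"
| "\<sigma> (Suc n) f =
     (if n < 2 then (\<lambda>z. 0)
      else if n = 2 then Schwarzian f
      else (\<lambda>z. deriv (\<sigma> n f) z - (of_nat n - 1) * \<sigma> n f z * pre_Schwarzian f z))"

end

theory Submission
  imports Defs
begin

text \<open>Write \<open>f' = \<phi> \<circ> \<omega>\<close> with \<open>\<phi> z = exp z * (1 + sin z) = 1 + 2 z + 3/2 z\<^sup>2 + 1/2 z\<^sup>3 + \<dots>\<close> and
  \<open>\<omega> z = c\<^sub>1 z + c\<^sub>2 z\<^sup>2 + c\<^sub>3 z\<^sup>3 + \<dots>\<close>. Comparing coefficients gives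
  \<open>\<sigma>\<^sub>3 = 4 c\<^sub>2 - 3 c\<^sub>1\<^sup>2\<close> and \<open>\<sigma>\<^sub>4 = 12 c\<^sub>3 - 30 c\<^sub>1 c\<^sub>2 + 15 c\<^sub>1\<^sup>3\<close> at the origin.
  Schur's algorithm parametrises \<open>c\<^sub>1 = a\<close>, \<open>c\<^sub>2 = (1 - \<bar>a\<bar>\<^sup>2) b\<close>,
  \<open>c\<^sub>3 = (1 - \<bar>a\<bar>\<^sup>2) (d - cnj a b\<^sup>2)\<close> with \<open>\<bar>a\<bar> \<le> 1\<close>, \<open>\<bar>b\<bar> \<le> 1\<close>, \<open>\<bar>d\<bar> \<le> 1 - \<bar>b\<bar>\<^sup>2\<close>.
  After a rotation making \<open>a\<close> real, the bound on \<open>\<sigma>\<^sub>4\<close> becomes a polynomial inequality in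
  \<open>\<bar>a\<bar>\<^sup>2\<close>, \<open>\<bar>b\<bar>\<^sup>2\<close> and the real part of the rotated \<open>b\<close>.
  Equality holds for \<open>\<omega> z = z\<^sup>2\<close> and \<open>\<omega> z = z\<close>, respectively.\<close>

section \<open>Schur's algorithm and coefficients of Schwarz functions\<close>

text \<open>The Moebius map taking \<open>g 0\<close> to 0 turns \<open>g\<close> into a function
  vanishing at 0, and the Schwarz lemma bounds its quotient \<open>h\<close> by \<open>z\<close>.
  The relation is free of fractions, so it also covers a unimodular constant \<open>g\<close>, with
  \<open>h = 0\<close>, and yields coefficients directly.\<close>

lemma Schur_step:
  assumes g: "g holomorphic_on \<D>" and le: "\<And>z. z \<in> \<D> \<Longrightarrow> norm (g z) \<le> 1"
  obtains h where "h holomorphic_on \<D>" "\<And>z. z \<in> \<D> \<Longrightarrow> norm (h z) \<le> 1"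
    "\<And>z. z \<in> \<D> \<Longrightarrow> g z * (1 + cnj (g 0) * z * h z) = g 0 + z * h z"
proof (cases "\<exists>\<xi>\<in>\<D>. norm (g \<xi>) = 1")
  case True
  then obtain \<xi> where \<xi>: "\<xi> \<in> \<D>" "norm (g \<xi>) = 1" by blast
  \<comment> \<open>The modulus attains its maximum at the interior point
    \<open>\<xi>\<close>.\<close>
  have "g constant_on \<D>"
    by (rule maximum_modulus_principle[OF g _ _ _ order_refl \<xi>(1)]) (use le \<xi> in auto)
  then obtain c where c: "\<And>z. z \<in> \<D> \<Longrightarrow> g z = c"
    unfolding constant_on_def by blast
  show ?thesis
    by (rule that[of "\<lambda>_. 0"]) (simp_all add: c)
next
  case False
  then have lt: "norm (g z) < 1" if "z \<in> \<D>" for z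
    using le[OF that] that by force
  define a where "a = g 0"
  have a: "norm a < 1" using lt[of 0] by (simp add: a_def)
  define m where "m = (\<lambda>z. Moebius_function 0 a (g z))"
  have m: "m holomorphic_on \<D>"
    using holomorphic_on_compose_gen[OF g Moebius_function_holomorphic[OF a]] lt
    by (auto simp: m_def o_def image_subset_iff)
  have m0: "m 0 = 0" by (simp add: m_def a_def Moebius_function_eq_zero)
  have m1: "norm (m z) < 1" if "norm z < 1" for z
    using Moebius_function_norm_lt_1[OF a] lt that by (simp add: m_def)
  obtain h where h: "h holomorphic_on \<D>" "\<And>z. norm z < 1 \<Longrightarrow> m z = z * h z" "deriv m 0 = h 0"
    using Schwarz3[OF m m0] by blast
  show ?thesis
  proof (rule that[OF h(1)])
    fix z :: complex assume z: "z \<in> \<D>"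
    show "norm (h z) \<le> 1"
    proof (cases "z = 0")
      case True
      then show ?thesis
        \<comment> \<open>Division by \<open>z\<close> fails here; \<open>h 0\<close> is the
          derivative of \<open>m\<close> at 0, which the Schwarz lemma bounds as well.\<close>
        using Schwarz_Lemma(2)[OF m m0 m1, of 0] h(3) by simp
    next
      case False
      have "norm (z * h z) \<le> norm z"
        using Schwarz_Lemma(1)[OF m m0 m1, of z] h(2)[of z] z by simp
      then show ?thesis using False by (simp add: norm_mult)
    qed
    have "norm (cnj a * g z) < 1"
      using norm_mult_less[of "cnj a" 1 "g z" 1] a lt[OF z] by simp
    then have nz: "1 - cnj a * g z \<noteq> 0" by auto
    have "z * h z * (1 - cnj a * g z) = g z - a"
      using h(2)[of z] z nz by (simp add: m_def Moebius_function_simple divide_simps)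
    then show "g z * (1 + cnj (g 0) * z * h z) = g 0 + z * h z"
      unfolding a_def by (simp add: algebra_simps)
  qed
qed

lemma holomorphic_disc_has_fps_expansion:
  assumes "g holomorphic_on \<D>"
  obtains G where "g has_fps_expansion G"
  using has_fps_expansion_fps_expansion[OF _ _ assms] by auto

lemma fps_expansion_unique_disc:
  assumes "f has_fps_expansion F" "g has_fps_expansion G" and eq: "\<And>z. z \<in> \<D> \<Longrightarrow> f z = g z"
  shows "F = G"
proof -
  have "\<forall>\<^sub>F z in nhds 0. z \<in> \<D>"
    by (rule eventually_nhds_in_open) auto
  then have ev: "\<forall>\<^sub>F z in nhds 0. f z = g z"
    by (rule eventually_mono) (rule eq)
  have "g has_fps_expansion F"
    using assms(1) has_fps_expansion_cong[OF ev refl] by simp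
  then show ?thesis
    using assms(2) by (rule fps_expansion_unique_complex)
qed

text \<open>The coefficients of z and z^2 in the relation of \<open>Schur_step\<close> are compared
  and solved for those of \<open>G\<close>, with |a|^2 = a \<open>cnj a\<close>.\<close>

lemma Schur_step_coeffs:
  assumes g: "g holomorphic_on \<D>" "\<And>z. z \<in> \<D> \<Longrightarrow> norm (g z) \<le> 1"
    and G: "g has_fps_expansion G"
  obtains h H where "h holomorphic_on \<D>" "\<And>z. z \<in> \<D> \<Longrightarrow> norm (h z) \<le> 1"
    "h has_fps_expansion H"
    "fps_nth G 1 = (1 - of_real ((norm (fps_nth G 0))\<^sup>2)) * fps_nth H 0"
    "fps_nth G 2 = (1 - of_real ((norm (fps_nth G 0))\<^sup>2)) *
        (fps_nth H 1 - cnj (fps_nth G 0) * (fps_nth H 0)\<^sup>2)"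
proof -
  obtain h where h: "h holomorphic_on \<D>" "\<And>z. z \<in> \<D> \<Longrightarrow> norm (h z) \<le> 1"
    and gh: "\<And>z. z \<in> \<D> \<Longrightarrow> g z * (1 + cnj (g 0) * z * h z) = g 0 + z * h z"
    using Schur_step[OF g] by blast
  obtain H where H: "h has_fps_expansion H"
    using holomorphic_disc_has_fps_expansion[OF h(1)] .
  define a where "a = g 0"
  have a: "fps_nth G 0 = a"
    using has_fps_expansion_imp_0_eq_fps_nth_0[OF G] by (simp add: a_def)
  have "(\<lambda>z. g z * (1 + cnj a * z * h z)) has_fps_expansion G * (1 + fps_const (cnj a) * fps_X * H)"
    by (intro fps_expansion_intros G H)
  moreover have "(\<lambda>z. a + z * h z) has_fps_expansion fps_const a + fps_X * H"
    by (intro fps_expansion_intros H)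
  ultimately have eq: "G * (1 + fps_const (cnj a) * fps_X * H) = fps_const a + fps_X * H"
    by (rule fps_expansion_unique_disc) (use gh in \<open>simp add: a_def\<close>)
  have aa: "of_real ((norm a)\<^sup>2) = a * cnj a"
    by (rule complex_norm_square)
  have 1: "fps_nth G 1 + a * cnj a * fps_nth H 0 = fps_nth H 0"
    using arg_cong[OF eq, of "\<lambda>F. fps_nth F 1"] a
    by (simp add: fps_mult_nth numeral_2_eq_2 algebra_simps)
  have 2: "fps_nth G 2 + cnj a * fps_nth G 1 * fps_nth H 0 + a * cnj a * fps_nth H 1 = fps_nth H 1"
    using arg_cong[OF eq, of "\<lambda>F. fps_nth F 2"] a
    by (simp add: fps_mult_nth numeral_2_eq_2 algebra_simps)
  show ?thesis
  proof (rule that[OF h H])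
    show *: "fps_nth G 1 = (1 - of_real ((norm (fps_nth G 0))\<^sup>2)) * fps_nth H 0"
      unfolding a aa using 1 by (simp add: algebra_simps)
    show "fps_nth G 2 = (1 - of_real ((norm (fps_nth G 0))\<^sup>2)) *
        (fps_nth H 1 - cnj (fps_nth G 0) * (fps_nth H 0)\<^sup>2)"
      using 2 unfolding * unfolding a aa by (simp add: algebra_simps power2_eq_square)
  qed
qed

lemma fps_nth_0_norm_le:
  assumes "g has_fps_expansion G" "\<And>z. z \<in> \<D> \<Longrightarrow> norm (g z) \<le> 1"
  shows "norm (fps_nth G 0) \<le> 1"
  using has_fps_expansion_imp_0_eq_fps_nth_0[OF assms(1)] assms(2)[of 0] by simp

lemma Schwarz_Pick_origin:
  assumes "g holomorphic_on \<D>" "\<And>z. z \<in> \<D> \<Longrightarrow> norm (g z) \<le> 1" "g has_fps_expansion G"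
  shows "norm (fps_nth G 1) \<le> 1 - (norm (fps_nth G 0))\<^sup>2"
proof -
  obtain h H where h: "\<And>z. z \<in> \<D> \<Longrightarrow> norm (h z) \<le> 1" "h has_fps_expansion H"
    and eq: "fps_nth G 1 = (1 - of_real ((norm (fps_nth G 0))\<^sup>2)) * fps_nth H 0"
    using Schur_step_coeffs[OF assms] by metis
  have "(norm (fps_nth G 0))\<^sup>2 \<le> 1"
    using fps_nth_0_norm_le[OF assms(3,2)] by (simp add: power_le_one)
  then have "norm (1 - of_real ((norm (fps_nth G 0))\<^sup>2) :: complex) = 1 - (norm (fps_nth G 0))\<^sup>2"
    by (metis abs_of_nonneg diff_ge_0_iff_ge norm_of_real of_real_1 of_real_diff)
  then show ?thesis
    unfolding eq norm_mult using fps_nth_0_norm_le[OF h(2,1)] \<open>(norm (fps_nth G 0))\<^sup>2 \<le> 1\<close>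
    by (simp add: mult_left_le)
qed

text \<open>Three Schur steps: \<open>\<omega>\<close> gives \<open>g\<close>, \<open>g\<close>
  gives \<open>h\<close>, and \<open>Schwarz_Pick_origin\<close> takes the last one on
  \<open>h\<close>. The parameters are a = g(0), b = h(0) and d = h'(0).\<close>

lemma Schwarz_function_coeffs:
  assumes \<omega>: "\<omega> holomorphic_on \<D>" "\<omega> 0 = 0" "\<And>z. z \<in> \<D> \<Longrightarrow> norm (\<omega> z) < 1"
    and W: "\<omega> has_fps_expansion W"
  obtains a b d :: complex where "norm a \<le> 1" "norm b \<le> 1" "norm d \<le> 1 - (norm b)\<^sup>2"
    "fps_nth W 1 = a" "fps_nth W 2 = (1 - of_real ((norm a)\<^sup>2)) * b"
    "fps_nth W 3 = (1 - of_real ((norm a)\<^sup>2)) * (d - cnj a * b\<^sup>2)"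
proof -
  obtain g where g: "g holomorphic_on \<D>" "\<And>z. z \<in> \<D> \<Longrightarrow> norm (g z) \<le> 1"
    and wg: "\<And>z. z \<in> \<D> \<Longrightarrow> \<omega> z = z * g z"
    \<comment> \<open>Since \<open>\<omega>\<close> vanishes at 0, the Schur relation collapses to
      division by \<open>z\<close>.\<close>
    using Schur_step[OF \<omega>(1) less_imp_le[OF \<omega>(3)]] \<omega>(2) by auto
  obtain G where G: "g has_fps_expansion G"
    using holomorphic_disc_has_fps_expansion[OF g(1)] .
  have "(\<lambda>z. z * g z) has_fps_expansion fps_X * G"
    by (intro fps_expansion_intros G)
  then have "W = fps_X * G"
    by (rule fps_expansion_unique_disc[OF W _ wg])
  then have W_nth: "fps_nth W 1 = fps_nth G 0" "fps_nth W 2 = fps_nth G 1" "fps_nth W 3 = fps_nth G 2"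
    by simp_all
  obtain h H where h: "h holomorphic_on \<D>" "\<And>z. z \<in> \<D> \<Longrightarrow> norm (h z) \<le> 1"
      "h has_fps_expansion H"
    and "fps_nth G 1 = (1 - of_real ((norm (fps_nth G 0))\<^sup>2)) * fps_nth H 0"
    "fps_nth G 2 = (1 - of_real ((norm (fps_nth G 0))\<^sup>2)) *
        (fps_nth H 1 - cnj (fps_nth G 0) * (fps_nth H 0)\<^sup>2)"
    using Schur_step_coeffs[OF g G] by blast
  then show ?thesis
    using that[OF fps_nth_0_norm_le[OF G g(2)] fps_nth_0_norm_le[OF h(3,2)] Schwarz_Pick_origin[OF h]]
      W_nth by simp
qed

section \<open>Sharp inequalities for the Schur parameters\<close>

lemma sigma4_real_ineq:
  fixes u t x :: real
  assumes u: "0 \<le> u" "u \<le> 1" and t: "0 \<le> t" "t \<le> 1"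
  shows "u * (25/16 * u\<^sup>2 - 5/2 * u * (1-u) * (2 * x\<^sup>2 - t + 5/2 * x)
            + (1-u)\<^sup>2 * t * (t + 5 * x + 25/4)) \<le> (5/4 - (1-u) * (1-t))\<^sup>2"
proof -
  \<comment> \<open>Completing the square in \<open>x\<close> leaves a remainder concave in \<open>t\<close>, hence bounded below by
     interpolating its values \<open>R0\<close> and \<open>R1\<close> at \<open>t = 0\<close> and \<open>t = 1\<close>.\<close>
  define R0 where "R0 = 1/16 + 9/16 * u - 25/64 * u\<^sup>2"
  define R1 where "R1 = 5/16 - u/16 - u\<^sup>2/64"
  have uu: "u\<^sup>2 \<le> u" using u by (simp add: power2_eq_square mult_left_le)
  have "R0 \<ge> 0" "R1 \<ge> 0" using uu u unfolding R0_def R1_def by linarith+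
  \<comment> \<open>The last summand is the exact gap between the remainder and its chord; the
    factor \<open>1-u\<close> reflects equality at \<open>u = 1\<close>.\<close>
  then have "0 \<le> (1-u) * (5 * (u*x + 5*u/8 - (1-u)*t/2)\<^sup>2 + (1-t)*R0 + t*R1 + t*(1-t)*(1-u)\<^sup>2/4)"
    using u t by (intro mult_nonneg_nonneg add_nonneg_nonneg divide_nonneg_pos) auto
  also have "\<dots> = (5/4 - (1-u) * (1-t))\<^sup>2 - u * (25/16 * u\<^sup>2 - 5/2 * u * (1-u) * (2 * x\<^sup>2 - t + 5/2 * x)
            + (1-u)\<^sup>2 * t * (t + 5 * x + 25/4))"
    unfolding R0_def R1_def by (simp add: field_simps power2_eq_square)
  finally show ?thesis by simp
qed

text \<open>Squaring reduces this to \<open>sigma4_real_ineq\<close>: the imaginary part of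
  \<open>w\<close> enters the squared norm only through its square, which is |w|^2 - (Re
  w)^2.\<close>

lemma sigma4_rotated_ineq:
  fixes w :: complex and r :: real
  assumes r: "0 \<le> r" "r \<le> 1" and w: "norm w \<le> 1"
  shows "r * norm (of_real (5/4 * r\<^sup>2) - of_real (1 - r\<^sup>2) * (w * (w + 5/2)))
           \<le> 5/4 - (1 - r\<^sup>2) * (1 - (norm w)\<^sup>2)"
proof -
  define t x y u where "t = (norm w)\<^sup>2" and "x = Re w" and "y = Im w" and "u = r\<^sup>2"
  have u: "0 \<le> u" "u \<le> 1" using r by (auto simp: u_def power_le_one)
  have t: "0 \<le> t" "t \<le> 1" using w by (auto simp: t_def power_le_one)
  have txy: "t = x\<^sup>2 + y\<^sup>2" by (simp add: t_def x_def y_def cmod_power2)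
  have w': "w = Complex x y" by (simp add: x_def y_def)
  have "(norm (of_real (5/4 * u) - of_real (1 - u) * (w * (w + 5/2))))\<^sup>2
      = (5/4 * u - (1-u) * (x * (x + 5/2) - y * y))\<^sup>2 + ((1-u) * (x * y + y * (x + 5/2)))\<^sup>2"
    unfolding cmod_power2 by (simp add: w')
  also have "\<dots> = 25/16 * u\<^sup>2 - 5/2 * u * (1-u) * (2 * x\<^sup>2 - t + 5/2 * x)
            + (1-u)\<^sup>2 * t * (t + 5 * x + 25/4)"
    unfolding txy by (simp add: field_simps power2_eq_square)
  finally have "(r * norm (of_real (5/4 * u) - of_real (1 - u) * (w * (w + 5/2))))\<^sup>2
      \<le> (5/4 - (1-u) * (1-t))\<^sup>2"
    using sigma4_real_ineq[OF u t, of x] by (simp add: power_mult_distrib u_def)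
  moreover have "(1-u) * (1-t) \<le> 1"
    using u t by (simp add: mult_le_one)
  then have "0 \<le> 5/4 - (1-u) * (1-t)" by simp
  ultimately show ?thesis
    unfolding u_def t_def by (rule power2_le_imp_le)
qed

text \<open>The triangle inequality separates the term in \<open>d\<close>. Its bound 1 - |b|^2,
  weighted by 1 - |a|^2, is exactly what \<open>sigma4_rotated_ineq\<close> leaves over, so the sum
  is at most 12 * 5/4 = 15.\<close>

lemma sigma4_schur_ineq:
  fixes a b d :: complex
  assumes a: "norm a \<le> 1" and b: "norm b \<le> 1" and d: "norm d \<le> 1 - (norm b)\<^sup>2"
  defines "m \<equiv> 1 - of_real ((norm a)\<^sup>2) :: complex"
  shows "norm (12 * (m * (d - cnj a * b\<^sup>2)) - 30 * a * (m * b) + 15 * a ^ 3) \<le> 15"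
proof (cases "a = 0")
  case True
  have "norm d \<le> 1" using d zero_le_power2[of "norm b"] by linarith
  then show ?thesis using True by (simp add: m_def norm_mult)
next
  case False
  \<comment> \<open>This rotation of \<open>b\<close> lets \<open>a\<^sup>2 / cnj a\<close>, of
    modulus \<open>r\<close>, be factored out of all terms without \<open>d\<close>.\<close>
  define r w where "r = norm a" and "w = b * cnj a / a"
  have r: "0 \<le> r" "r \<le> 1" using a by (auto simp: r_def)
  have m: "m = of_real (1 - r\<^sup>2)" by (simp add: m_def r_def)
  have nw: "norm w = norm b" using False by (simp add: w_def norm_mult norm_divide)
  have b': "b = w * a / cnj a" using False by (simp add: w_def)
  have aa: "of_real (r\<^sup>2) = a * cnj a" unfolding r_def by (rule complex_norm_square)
  have r1: "0 \<le> 1 - r\<^sup>2" using r by (simp add: power_le_one)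
  have nm: "norm m = 1 - r\<^sup>2" unfolding m norm_of_real using r1 by simp
  have "12 * (m * (d - cnj a * b\<^sup>2)) - 30 * a * (m * b) + 15 * a ^ 3
     = 12 * (m * d + a\<^sup>2 / cnj a * (of_real (5/4 * r\<^sup>2) - m * (w * (w + 5/2))))"
    using False unfolding b' of_real_mult aa
    by (simp add: field_simps power2_eq_square power3_eq_cube)
  also have "norm \<dots> \<le> 12 * (norm (m * d) +
      norm (a\<^sup>2 / cnj a * (of_real (5/4 * r\<^sup>2) - m * (w * (w + 5/2)))))"
    unfolding norm_mult[of 12] norm_numeral by (intro mult_left_mono norm_triangle_ineq) auto
  also have "\<dots> = 12 * ((1 - r\<^sup>2) * norm d +
      r * norm (of_real (5/4 * r\<^sup>2) - of_real (1 - r\<^sup>2) * (w * (w + 5/2))))"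
    using False nm unfolding m[symmetric]
    by (simp add: norm_mult norm_divide norm_power r_def power2_eq_square)
  also have "\<dots> \<le> 12 * ((1 - r\<^sup>2) * (1 - (norm b)\<^sup>2) + (5/4 - (1 - r\<^sup>2) * (1 - (norm b)\<^sup>2)))"
    using sigma4_rotated_ineq[OF r, of w] b unfolding nw
    by (intro mult_left_mono[OF d r1] mult_left_mono[OF add_mono]) auto
  finally show ?thesis by simp
qed

lemma sigma3_schur_ineq:
  fixes a b :: complex
  assumes a: "norm a \<le> 1" and b: "norm b \<le> 1"
  shows "norm (4 * ((1 - of_real ((norm a)\<^sup>2)) * b) - 3 * a\<^sup>2) \<le> 4"
proof -
  have a2: "(norm a)\<^sup>2 \<le> 1" using a by (simp add: power_le_one)
  then have m: "norm (1 - of_real ((norm a)\<^sup>2) :: complex) = 1 - (norm a)\<^sup>2"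
    by (metis abs_of_nonneg diff_ge_0_iff_ge norm_of_real of_real_1 of_real_diff)
  have "norm (4 * ((1 - of_real ((norm a)\<^sup>2)) * b) - 3 * a\<^sup>2)
      \<le> 4 * ((1 - (norm a)\<^sup>2) * norm b) + 3 * (norm a)\<^sup>2"
    by (rule order_trans[OF norm_triangle_ineq4]) (simp only: norm_mult m norm_power norm_numeral)
  also have "\<dots> \<le> 4 * (1 - (norm a)\<^sup>2) + 3 * (norm a)\<^sup>2"
    using mult_left_le[of "norm b" "1 - (norm a)\<^sup>2"] a2 b by simp
  also have "\<dots> \<le> 4" by simp
  finally show ?thesis .
qed

section \<open>Schwarzian derivatives through power series\<close>

text \<open>As \<open>G\<close> expands f', its coefficients are 2 a_2, 3 a_3, 4 a_4, and the values
  are the familiar 6(a_3 - a_2^2) and 24(a_4 - 3 a_2 a_3 + 2 a_2^3).\<close>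

lemma higher_Schwarzian_at_0:
  assumes G: "deriv f has_fps_expansion G" and G0: "fps_nth G 0 = 1"
  shows "\<sigma> 3 f 0 = 2 * fps_nth G 2 - 3/2 * (fps_nth G 1)\<^sup>2"
    and "\<sigma> 4 f 0 = 6 * fps_nth G 3 - 12 * fps_nth G 1 * fps_nth G 2 + 6 * fps_nth G 1 ^ 3"
proof -
  define P where "P = fps_deriv G / G"
  define S where "S = fps_deriv P - fps_const (1/2) * P\<^sup>2"
  have P: "pre_Schwarzian f has_fps_expansion P"
    unfolding pre_Schwarzian_def[abs_def] P_def
    by (intro fps_expansion_intros G) (use G0 in auto)
  have S: "Schwarzian f has_fps_expansion S"
    unfolding Schwarzian_def[abs_def] S_def power2_eq_square
    by (intro fps_expansion_intros P)
  have s3: "\<sigma> 3 f = Schwarzian f"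
    by (simp add: numeral_3_eq_3)
  have s4: "\<sigma> 4 f = (\<lambda>z. deriv (Schwarzian f) z - 2 * Schwarzian f z * pre_Schwarzian f z)"
    using higher_Schwarzian.simps(2)[of 3 f] by (simp add: s3)
  have S4: "\<sigma> 4 f has_fps_expansion fps_deriv S - fps_const 2 * S * P"
    unfolding s4 by (intro fps_expansion_intros S P)
  \<comment> \<open>Multiplying out the quotient makes the coefficients of \<open>P\<close>
    computable one after another.\<close>
  have PG: "P * G = fps_deriv G"
    unfolding P_def using G0 by (simp add: fps_divide_unit mult.assoc inverse_mult_eq_1)
  have P0: "fps_nth P 0 = fps_nth G 1"
    using arg_cong[OF PG, of "\<lambda>F. fps_nth F 0"] G0 by simp
  have P1: "fps_nth P 1 = 2 * fps_nth G 2 - (fps_nth G 1)\<^sup>2"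
    using arg_cong[OF PG, of "\<lambda>F. fps_nth F 1"] G0 P0
    by (simp add: fps_mult_nth numeral_2_eq_2 power2_eq_square algebra_simps)
  have "fps_nth P 2 + fps_nth P 1 * fps_nth G 1 + fps_nth P 0 * fps_nth G 2 = 3 * fps_nth G 3"
    using arg_cong[OF PG, of "\<lambda>F. fps_nth F 2"] G0
    by (simp add: fps_mult_nth eval_nat_numeral algebra_simps)
  then have P2: "fps_nth P 2 = 3 * fps_nth G 3 - 3 * fps_nth G 1 * fps_nth G 2 + fps_nth G 1 ^ 3"
    unfolding P0 P1 by (simp add: algebra_simps power2_eq_square power3_eq_cube)
  have S0: "fps_nth S 0 = fps_nth P 1 - 1/2 * (fps_nth P 0)\<^sup>2"
    by (simp add: S_def power2_eq_square)
  have S1: "fps_nth S 1 = 2 * fps_nth P 2 - fps_nth P 0 * fps_nth P 1"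
    by (simp add: S_def power2_eq_square fps_mult_nth numeral_2_eq_2)
  show "\<sigma> 3 f 0 = 2 * fps_nth G 2 - 3/2 * (fps_nth G 1)\<^sup>2"
    using has_fps_expansion_imp_0_eq_fps_nth_0[OF S] unfolding s3 S0 P0 P1 by simp
  have "\<sigma> 4 f 0 = fps_nth S 1 - 2 * fps_nth S 0 * fps_nth P 0"
    using has_fps_expansion_imp_0_eq_fps_nth_0[OF S4] by simp
  also have "\<dots> = 6 * fps_nth G 3 - 12 * fps_nth G 1 * fps_nth G 2 + 6 * fps_nth G 1 ^ 3"
    unfolding S0 S1 P0 P1 P2 by (simp add: field_simps power2_eq_square power3_eq_cube)
  finally show "\<sigma> 4 f 0 = 6 * fps_nth G 3 - 12 * fps_nth G 1 * fps_nth G 2 + 6 * fps_nth G 1 ^ 3" .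
qed

text \<open>Since \<open>W\<close> has no constant term, only the Taylor coefficients of exp(z)(1 +
  sin z) up to order 3 affect those of f' up to order 3.\<close>

lemma higher_Schwarzian_subordinate:
  assumes eq: "\<And>z. z \<in> \<D> \<Longrightarrow> deriv f z = exp (\<omega> z) * (1 + sin (\<omega> z))"
    and W: "\<omega> has_fps_expansion W" and W0: "fps_nth W 0 = 0"
  shows "\<sigma> 3 f 0 = 4 * fps_nth W 2 - 3 * (fps_nth W 1)\<^sup>2"
    and "\<sigma> 4 f 0 = 12 * fps_nth W 3 - 30 * fps_nth W 1 * fps_nth W 2 + 15 * fps_nth W 1 ^ 3"
proof -
  define \<Phi> :: "complex fps" where "\<Phi> = fps_exp 1 * (1 + fps_sin 1)"
  have \<Phi>: "(\<lambda>z. exp z * (1 + sin z)) has_fps_expansion \<Phi>"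
    unfolding \<Phi>_def by (intro fps_expansion_intros)
  have \<Phi>_nth: "fps_nth \<Phi> 0 = 1" "fps_nth \<Phi> (Suc 0) = 2" "fps_nth \<Phi> (Suc (Suc 0)) = 3/2"
    "fps_nth \<Phi> (Suc (Suc (Suc 0))) = 1/2"
    by (simp_all add: \<Phi>_def fps_mult_nth fps_sin_def fact_numeral)
  define G where "G = fps_compose \<Phi> W"
  have "((\<lambda>z. exp z * (1 + sin z)) \<circ> \<omega>) has_fps_expansion G"
    unfolding G_def by (intro has_fps_expansion_compose \<Phi> W W0)
  moreover have "\<forall>\<^sub>F z in nhds 0. z \<in> \<D>"
    by (rule eventually_nhds_in_open) auto
  then have "\<forall>\<^sub>F z in nhds 0. deriv f z = ((\<lambda>z. exp z * (1 + sin z)) \<circ> \<omega>) z"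
    by (rule eventually_mono) (simp add: eq)
  ultimately have G: "deriv f has_fps_expansion G"
    using has_fps_expansion_cong[OF _ refl] by metis
  have G0: "fps_nth G 0 = 1" by (simp add: G_def \<Phi>_nth)
  have G1: "fps_nth G 1 = 2 * fps_nth W 1"
    by (simp add: G_def fps_compose_nth \<Phi>_nth)
  have G2: "fps_nth G 2 = 2 * fps_nth W 2 + 3/2 * (fps_nth W 1)\<^sup>2"
    by (simp add: G_def fps_compose_nth \<Phi>_nth numeral_2_eq_2 fps_mult_nth W0)
  have G3: "fps_nth G 3 = 2 * fps_nth W 3 + 3 * fps_nth W 1 * fps_nth W 2 + 1/2 * fps_nth W 1 ^ 3"
    by (simp add: G_def fps_compose_nth \<Phi>_nth eval_nat_numeral fps_mult_nth W0)
  show "\<sigma> 3 f 0 = 4 * fps_nth W 2 - 3 * (fps_nth W 1)\<^sup>2"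
    unfolding higher_Schwarzian_at_0[OF G G0] G1 G2 by (simp add: power_mult_distrib)
  show "\<sigma> 4 f 0 = 12 * fps_nth W 3 - 30 * fps_nth W 1 * fps_nth W 2 + 15 * fps_nth W 1 ^ 3"
    unfolding higher_Schwarzian_at_0[OF G G0] G1 G2 G3
    by (simp add: algebra_simps power2_eq_square power3_eq_cube)
qed

section \<open>Extremal functions and the sharp bounds\<close>

text \<open>Every Schwarz function comes from a member of the class, because the prescribed
  derivative has a primitive on the convex disc. This supplies the extremal functions.\<close>

lemma class_P_star_primitive:
  assumes \<omega>: "\<omega> holomorphic_on \<D>" "\<omega> 0 = 0" "\<And>z. z \<in> \<D> \<Longrightarrow> norm (\<omega> z) < 1"
  obtains f where "f \<in> class_P_star" "\<And>z. z \<in> \<D> \<Longrightarrow> deriv f z = exp (\<omega> z) * (1 + sin (\<omega> z))"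
proof -
  have hol: "(\<lambda>z. exp (\<omega> z) * (1 + sin (\<omega> z))) holomorphic_on \<D>"
    by (intro holomorphic_intros \<omega>)
  obtain F where F: "\<And>z. z \<in> \<D> \<Longrightarrow>
      (F has_field_derivative exp (\<omega> z) * (1 + sin (\<omega> z))) (at z within \<D>)"
    using holomorphic_convex_primitive'[OF convex_ball open_ball hol] by blast
  define f where "f = (\<lambda>z. F z - F 0)"
  have f: "(f has_field_derivative exp (\<omega> z) * (1 + sin (\<omega> z))) (at z)" if "z \<in> \<D>" for z
    using F[OF that] that unfolding f_def at_within_open[OF that open_ball]
    by (auto intro!: derivative_eq_intros)
  have deriv: "deriv f z = exp (\<omega> z) * (1 + sin (\<omega> z))" if "z \<in> \<D>" for z
    using f[OF that] by (rule DERIV_imp_deriv)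
  have "f holomorphic_on \<D>"
    using f by (meson holomorphic_onI field_differentiable_at_within field_differentiable_def)
  then have "f \<in> class_A"
    using deriv[of 0] \<omega>(2) by (simp add: class_A_def f_def)
  moreover have "deriv f holomorphic_on \<D>"
    using hol by (rule holomorphic_transform) (simp add: deriv)
  then have "deriv f \<prec>\<^sub>D (\<lambda>z. exp z * (1 + sin z))"
    unfolding subordinate_def using \<omega> deriv by (auto intro!: holomorphic_intros)
  ultimately show ?thesis
    using that deriv by (simp add: class_P_star_def)
qed

theorem theorem3p1:
  shows "(\<forall>f\<in>class_P_star. norm (\<sigma> 3 f 0) \<le> 4 \<and> norm (\<sigma> 4 f 0) \<le> 15) \<and>
         (\<exists>f\<in>class_P_star. norm (\<sigma> 3 f 0) = 4) \<and>
         (\<exists>f\<in>class_P_star. norm (\<sigma> 4 f 0) = 15)"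
proof (intro conjI ballI)
  fix f assume "f \<in> class_P_star"
  then obtain \<omega> where \<omega>: "\<omega> holomorphic_on \<D>" "\<omega> 0 = 0" "\<And>z. z \<in> \<D> \<Longrightarrow> norm (\<omega> z) < 1"
    and eq: "\<And>z. z \<in> \<D> \<Longrightarrow> deriv f z = exp (\<omega> z) * (1 + sin (\<omega> z))"
    unfolding class_P_star_def subordinate_def by blast
  obtain W where W: "\<omega> has_fps_expansion W"
    using holomorphic_disc_has_fps_expansion[OF \<omega>(1)] .
  have W0: "fps_nth W 0 = 0"
    using has_fps_expansion_imp_0_eq_fps_nth_0[OF W] \<omega>(2) by simp
  obtain a b d :: complex where abd: "norm a \<le> 1" "norm b \<le> 1" "norm d \<le> 1 - (norm b)\<^sup>2"
    and W_nth: "fps_nth W 1 = a" "fps_nth W 2 = (1 - of_real ((norm a)\<^sup>2)) * b"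
      "fps_nth W 3 = (1 - of_real ((norm a)\<^sup>2)) * (d - cnj a * b\<^sup>2)"
    using Schwarz_function_coeffs[OF \<omega> W] by metis
  have "\<sigma> 3 f 0 = 4 * ((1 - of_real ((norm a)\<^sup>2)) * b) - 3 * a\<^sup>2"
    using higher_Schwarzian_subordinate(1)[OF eq W W0] unfolding W_nth by simp
  with sigma3_schur_ineq[OF abd(1,2)] show "norm (\<sigma> 3 f 0) \<le> 4"
    by (simp only:)
  have "\<sigma> 4 f 0 = 12 * ((1 - of_real ((norm a)\<^sup>2)) * (d - cnj a * b\<^sup>2))
      - 30 * a * ((1 - of_real ((norm a)\<^sup>2)) * b) + 15 * a ^ 3"
    using higher_Schwarzian_subordinate(2)[OF eq W W0] unfolding W_nth by simp
  with sigma4_schur_ineq[OF abd] show "norm (\<sigma> 4 f 0) \<le> 15"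
    by (simp only:)
next
  \<comment> \<open>Here c_1 = 0 and c_2 = 1, so 4 c_2 - 3 c_1^2 equals 4.\<close>
  obtain f where f: "f \<in> class_P_star"
    "\<And>z. z \<in> \<D> \<Longrightarrow> deriv f z = exp (z\<^sup>2) * (1 + sin (z\<^sup>2))"
    by (rule class_P_star_primitive[of "\<lambda>z. z\<^sup>2"])
      (auto intro!: holomorphic_intros simp: norm_power power_less_one_iff)
  have "norm (\<sigma> 3 f 0) = 4"
    using higher_Schwarzian_subordinate(1)[OF f(2) has_fps_expansion_fps_X_power[of 2]]
    by (simp add: fps_X_power_nth)
  with f(1) show "\<exists>f\<in>class_P_star. norm (\<sigma> 3 f 0) = 4" by blast
next
  \<comment> \<open>Here c_1 = 1 and c_2 = c_3 = 0, so only 15 c_1^3 survives.\<close>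
  obtain f where f: "f \<in> class_P_star"
    "\<And>z. z \<in> \<D> \<Longrightarrow> deriv f z = exp z * (1 + sin z)"
    by (rule class_P_star_primitive[of "\<lambda>z. z"]) auto
  have "norm (\<sigma> 4 f 0) = 15"
    using higher_Schwarzian_subordinate(2)[OF f(2) has_fps_expansion_fps_X] by simp
  with f(1) show "\<exists>f\<in>class_P_star. norm (\<sigma> 4 f 0) = 15" by blast
qed

end
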